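(* Let $\Omega$ be a finite set, let $\mathbf{F}\subseteq 2^{\Omega}$ be a set algebra with $\Omega\in\mathbf{F}$, and let $P:\mathbf{F}\to[0,1]$ be a classical probability function. Then $P$, regarded as a mapping into the scale $X=[0,1]$ with the natural order $>$ of the real numbers (and with universe of events $U=\Omega$), is a complete rigid positive probability structure.
   Context: A set algebra is a collection of sets closed under union, intersection and difference. A function $P:\mathbf{F}\to[0,1]$ is a classical probability function if: (K1) $P(A)\ge 0$ for all $A\in\mathbf{F}$; (K2) $P(\Omega)=1$; (K3) $P(A\cup B)=P(A)+P(B)$ for all $A,B\in\mathbf{F}$ with $A\cap B=\emptyset$. Positive probability structure: let $U$ be a finite set (the universe of events), $\mathbf{F}$ a family of subsets of $U$ with $U\in\mathbf{F}$ that is a Boolean algebra under the set operations, or a set algebra, or a set field (a set algebra closed under complement in $U$); elements of $\mathbf{F}$ are called permissible events. Let $X$ (the scale) be a set with a strict partial order $\succ$; $a\succcurlyeq b$ means $a\succ b$ or $a=b$. A mapping $P:\mathbf{F}\to X$ is a positive probability structure if: (PNA) if $U\ne\emptyset$ then $P(U)\succ P(\emptyset)$; (ICA) for all $A,B\in\mathbf{F}$, if $A\supseteq B$ then $P(A)\succcurlyeq P(B)$; (PAA) for all $A,B,C\in\mathbf{F}$ with $A\cap C=B\cap C=\emptyset$: $P(A)\succ P(B)\Leftrightarrow P(A\cup C)\succ P(B\cup C)$. It is rigid if for all $A,B,C\in\mathbf{F}$ with $A\cap C=B\cap C=\emptyset$: $P(A)=P(B)\Leftrightarrow P(A\cup C)=P(B\cup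 C)$. It is complete if $\succ$ is a total strict order on the image $P(\mathbf{F})$, i.e. any two distinct elements of $P(\mathbf{F})$ are comparable. *)

theory Defs
  imports "HOL-Analysis.Sigma_Algebra"
begin

definition set_algebra :: "'a set set \<Rightarrow> bool" where
  "set_algebra F \<longleftrightarrow>
     (\<forall>A\<in>F. \<forall>B\<in>F. A \<union> B \<in> F \<and> A \<inter> B \<in> F \<and> A - B \<in> F)"

definition set_field :: "'a set \<Rightarrow> 'a set set \<Rightarrow> bool" where
  "set_field U F \<longleftrightarrow> set_algebra F \<and> (\<forall>A\<in>F. U - A \<in> F)"

text \<open>A classical probability function is only finitely additive. The type of \<open>P\<close> is total;
  only its values on the family \<open>F\<close> are ever constrained or used.\<close>

definition classical_probability :: "'a set \<Rightarrow> 'a set set \<Rightarrow> ('a set \<Rightarrow> real) \<Rightarrow> bool" where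
  "classical_probability \<Omega> F P \<longleftrightarrow>
     P \<in> F \<rightarrow> {0..1} \<and>
     (\<forall>A\<in>F. P A \<ge> 0) \<and>
     P \<Omega> = 1 \<and>
     (\<forall>A\<in>F. \<forall>B\<in>F. A \<inter> B = {} \<longrightarrow> P (A \<union> B) = P A + P B)"

text \<open>A Boolean algebra of subsets of \<open>U\<close> under the set operations is the library's
  \<^const>\<open>algebra\<close>, which includes \<open>F \<subseteq> Pow U\<close>, \<open>{} \<in> F\<close> and \<open>U \<in> F\<close>.\<close>

definition permissible_events :: "'a set \<Rightarrow> 'a set set \<Rightarrow> bool" where
  "permissible_events U F \<longleftrightarrow>
     finite U \<and> F \<subseteq> Pow U \<and> U \<in> F \<and> (algebra U F \<or> set_algebra F \<or> set_field U F)"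

definition strict_partial_order_on :: "'b set \<Rightarrow> ('b \<Rightarrow> 'b \<Rightarrow> bool) \<Rightarrow> bool" where
  "strict_partial_order_on X gt \<longleftrightarrow> irreflp_on X gt \<and> transp_on X gt"

text \<open>The scale is the carrier \<open>X\<close> with the relation \<open>gt\<close>, where \<open>gt a b\<close> reads \<open>a \<succ> b\<close>.\<close>

definition positive_probability_structure ::
    "'a set \<Rightarrow> 'a set set \<Rightarrow> 'b set \<Rightarrow> ('b \<Rightarrow> 'b \<Rightarrow> bool) \<Rightarrow> ('a set \<Rightarrow> 'b) \<Rightarrow> bool" where
  "positive_probability_structure U F X gt P \<longleftrightarrow>
     permissible_events U F \<and>
     strict_partial_order_on X gt \<and>
     P \<in> F \<rightarrow> X \<and>
     \<comment> \<open>PNA\<close>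
     (U \<noteq> {} \<longrightarrow> gt (P U) (P {})) \<and>
     \<comment> \<open>ICA\<close>
     (\<forall>A\<in>F. \<forall>B\<in>F. A \<supseteq> B \<longrightarrow> gt (P A) (P B) \<or> P A = P B) \<and>
     \<comment> \<open>PAA\<close>
     (\<forall>A\<in>F. \<forall>B\<in>F. \<forall>C\<in>F. A \<inter> C = {} \<and> B \<inter> C = {} \<longrightarrow>
        (gt (P A) (P B) \<longleftrightarrow> gt (P (A \<union> C)) (P (B \<union> C))))"

definition rigid :: "'a set set \<Rightarrow> ('a set \<Rightarrow> 'b) \<Rightarrow> bool" where
  "rigid F P \<longleftrightarrow>
     (\<forall>A\<in>F. \<forall>B\<in>F. \<forall>C\<in>F. A \<inter> C = {} \<and> B \<inter> C = {} \<longrightarrow>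
        (P A = P B \<longleftrightarrow> P (A \<union> C) = P (B \<union> C)))"

text \<open>Irreflexivity and transitivity on the image are inherited from the scale, so completeness
  only adds comparability of distinct elements.\<close>

definition complete_on_image ::
    "'a set set \<Rightarrow> ('b \<Rightarrow> 'b \<Rightarrow> bool) \<Rightarrow> ('a set \<Rightarrow> 'b) \<Rightarrow> bool" where
  "complete_on_image F gt P \<longleftrightarrow> totalp_on (P ` F) gt"

definition complete_rigid_positive_probability_structure ::
    "'a set \<Rightarrow> 'a set set \<Rightarrow> 'b set \<Rightarrow> ('b \<Rightarrow> 'b \<Rightarrow> bool) \<Rightarrow> ('a set \<Rightarrow> 'b) \<Rightarrow> bool" where
  "complete_rigid_positive_probability_structure U F X gt P \<longleftrightarrow>
     positive_probability_structure U F X gt P \<and> rigid F P \<and> complete_on_image F gt P"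

end

theory Submission
  imports Defs
begin

text \<open>
  Everything rests on cancellation in the ordered group of reals. If \<open>C\<close> is disjoint from both
  \<open>A\<close> and \<open>B\<close>, additivity turns the passage from \<open>(A, B)\<close> to \<open>(A \<union> C, B \<union> C)\<close> into adding the
  same number \<open>P C\<close> on both sides, which neither creates nor destroys a strict inequality (PAA)
  or an equality (rigidity). Splitting a set \<open>A\<close> into a subset \<open>B\<close> and the difference \<open>A - B\<close>
  gives monotonicity (ICA), since \<open>P (A - B) \<ge> 0\<close>; and additivity forces \<open>P {} = 0 < 1 = P \<Omega>\<close>
  (PNA). Completeness is the linearity of the order of the reals.
\<close>

lemma classical_probability_Un_disjoint:
  assumes "classical_probability \<Omega> F P" "A \<in> F" "B \<in> F" "A \<inter> B = {}"
  shows "P (A \<union> B) = P A + P B"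
  using assms unfolding classical_probability_def by blast

text \<open>The empty set is disjoint from itself, so its probability equals twice itself.\<close>

lemma classical_probability_empty:
  assumes "classical_probability \<Omega> F P" "{} \<in> F"
  shows "P {} = 0"
  using classical_probability_Un_disjoint[OF assms(1) assms(2) assms(2)] by simp

lemma classical_probability_mono:
  assumes "set_algebra F" "classical_probability \<Omega> F P" "A \<in> F" "B \<in> F" "B \<subseteq> A"
  shows "P B \<le> P A"
proof -
  have diff: "A - B \<in> F"
    using assms unfolding set_algebra_def by blast
  have "P (B \<union> (A - B)) = P B + P (A - B)"
    using classical_probability_Un_disjoint[OF assms(2) assms(4) diff] by simp
  moreover have "B \<union> (A - B) = A"
    using assms(5) by blast
  moreover have "0 \<le> P (A - B)"
    using assms(2) diff unfolding classical_probability_def by blast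
  ultimately show ?thesis
    by simp
qed

theorem theorem2p2:
  fixes \<Omega> :: "'a set" and F :: "'a set set" and P :: "'a set \<Rightarrow> real"
  assumes "finite \<Omega>"
    and "F \<subseteq> Pow \<Omega>"
    and "set_algebra F"
    and "\<Omega> \<in> F"
    and "classical_probability \<Omega> F P"
  shows "complete_rigid_positive_probability_structure \<Omega> F {0..1} (>) P"
proof -
  note additive = classical_probability_Un_disjoint[OF assms(5)]
  \<comment> \<open>A set algebra may be empty as a family, so \<open>{} \<in> F\<close> is obtained from \<open>\<Omega> \<in> F\<close>.\<close>
  have "\<Omega> - \<Omega> \<in> F"
    using assms(3,4) unfolding set_algebra_def by blast
  then have P_empty: "P {} = 0"
    using classical_probability_empty[OF assms(5)] by simp
  have range: "P \<in> F \<rightarrow> {0..1}" and P_univ: "P \<Omega> = 1"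
    using assms(5) unfolding classical_probability_def by blast+
  have events: "permissible_events \<Omega> F"
    using assms(1-4) unfolding permissible_events_def by blast
  have order: "strict_partial_order_on {0..1::real} (>)"
    unfolding strict_partial_order_on_def by (auto intro: irreflp_onI transp_onI)
  have ICA: "P A > P B \<or> P A = P B" if "A \<in> F" "B \<in> F" "B \<subseteq> A" for A B
    using classical_probability_mono[OF assms(3,5) that] by linarith
  have PAA: "P A > P B \<longleftrightarrow> P (A \<union> C) > P (B \<union> C)"
    and rigid: "P A = P B \<longleftrightarrow> P (A \<union> C) = P (B \<union> C)"
    if "A \<in> F" "B \<in> F" "C \<in> F" "A \<inter> C = {}" "B \<inter> C = {}" for A B C
    using additive[OF that(1,3,4)] additive[OF that(2,3,5)] by simp_all
  have "positive_probability_structure \<Omega> F {0..1} (>) P"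
    unfolding positive_probability_structure_def
    using events order range P_empty P_univ ICA PAA by simp
  moreover have "rigid F P"
    unfolding rigid_def using rigid by blast
  moreover have "complete_on_image F (>) P"
    unfolding complete_on_image_def by (auto intro: totalp_onI)
  ultimately show ?thesis
    unfolding complete_rigid_positive_probability_structure_def by blast
qed

end
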